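(* Let $0<R<1$ and $0<\mu\le 1-R$ with $(1-R)/\mu$ an integer. Let $\alpha(R,\mu)=\inf\{\ell>0:\sigma_\ell(R,\mu)\ge0\}$ be the critical exponent of the redundant random ensemble. Then $$\alpha_L(R,\mu)\le\alpha(R,\mu)\le\alpha_U(R,\mu),$$ where $\alpha_L(R,\mu)$ is the minimum positive solution $\ell$ of $H(\ell)-(1-R)(1-\ell/\mu)=0$ and $\alpha_U(R,\mu)$ is the minimum positive solution $\ell$ of $H(\ell)-(1-R)=0$.
   Context: $H(x)=-x\log_2x-(1-x)\log_2(1-x)$, $x\in[0,1]$, is the binary entropy function (with $0\log_2 0=0$). For $h,x\in\{0,1\}^n$ let $h\circ x=\sum_i h_ix_i$, computed in the integers. For a binary matrix $M$ with $n$ columns, $x\in\{0,1\}^n$ is a stopping set (SS) vector of $M$ if no row $h$ of $M$ satisfies $h\circ x=1$. $S_w(M)$ is the number of SS vectors of $M$ of Hamming weight $w$. Redundant extension: for a binary $m\times n$ matrix $H$ ($1\le m<n$) and a positive divisor $L$ of $m$, partition the rows into $m/L$ consecutive blocks of $L$ rows; $H^{(L)}$ is the $(2^L-1)(m/L)\times n$ matrix whose rows are, for each block, all $2^L-1$ linear combinations over $F_2$ of its $L$ rows with nonzero coefficient vector. $\mathcal R_{m,n}$ is the set of all $2^{mn}$ binary $m\times n$ matrices, and the redundant random ensemble $\mathcal R_{m,n}^{(L)}$ is the family $\{H^{(L)}:H\in\mathcal R_{m,n}\}$ with the uniform probability $2^{-mn}$ on the index $H$; its average SS weight distribution is $S_w^{\mathcal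 R_{m,n}^{(L)}}=2^{-mn}\sum_{H\in\mathcal R_{m,n}}S_w(H^{(L)})$. The asymptotic growth rate is $$\sigma_\ell(R,\mu)=\lim_{n\to\infty}\frac1n\log_2 S_{\ell n}^{\mathcal R_{(1-R)n,n}^{(\mu n)}}.$$ Here $R,\mu$ are rational, $\ell$ ranges over rationals in $(0,1]$, the limit is over those $n$ for which $(1-R)n$, $\mu n$ and $\ell n$ are integers, and the limit is assumed to exist for every rational $\ell\in(0,1]$. The infimum defining $\alpha(R,\mu)$ is over such $\ell$. *)

theory Defs
  imports
    "Jordan_Normal_Form.Matrix"
    "HOL-Library.Z2"
    "HOL-Real_Asymp.Real_Asymp"
begin

section \<open>Stopping sets\<close>

definition int_ip :: "bit vec \<Rightarrow> bit vec \<Rightarrow> int" where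
  "int_ip h x = (\<Sum>i<dim_vec x. of_bit (h $ i) * of_bit (x $ i))"

definition hamming_weight :: "bit vec \<Rightarrow> nat" where
  "hamming_weight x = card {i. i < dim_vec x \<and> x $ i = 1}"

definition stopping_set_vec :: "bit mat \<Rightarrow> bit vec \<Rightarrow> bool" where
  "stopping_set_vec M x \<longleftrightarrow>
     x \<in> carrier_vec (dim_col M) \<and> (\<forall>i<dim_row M. int_ip (row M i) x \<noteq> 1)"

definition ss_count :: "nat \<Rightarrow> bit mat \<Rightarrow> nat" where
  "ss_count w M = card {x. stopping_set_vec M x \<and> hamming_weight x = w}"


section \<open>Redundant extension and redundant random ensemble\<close>

text \<open>
  The nonzero coefficient vectors of length \<open>L\<close> are enumerated by the binary expansions of the
  numbers \<open>1, \<dots>, 2 ^ L - 1\<close>: row \<open>i\<close> of the extension belongs to block \<open>i div (2 ^ L - 1)\<close>, and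
  its coefficient vector is the binary expansion of \<open>i mod (2 ^ L - 1) + 1\<close>.
  Only meaningful if \<open>L\<close> is a positive divisor of the number of rows.
\<close>

definition red_ext :: "nat \<Rightarrow> bit mat \<Rightarrow> bit mat" where
  "red_ext L H = mat ((2 ^ L - 1) * (dim_row H div L)) (dim_col H)
     (\<lambda>(i, k). let b = i div (2 ^ L - 1); c = i mod (2 ^ L - 1) + 1 in
        \<Sum>t<L. of_bool (bit c t) * H $$ (b * L + t, k))"

lemma set_rows_red_ext:
  assumes "L > 0"
  shows "set (rows (red_ext L H)) =
    {vec (dim_col H) (\<lambda>k. \<Sum>t<L. c $ t * H $$ (b * L + t, k)) | b c.
       b < dim_row H div L \<and> c \<in> carrier_vec L \<and> c \<noteq> 0\<^sub>v L}" (is "?A = ?B")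
proof -
  define N :: nat where "N = 2 ^ L - 1"
  define q where "q = dim_row H div L"
  have N: "N > 0" "N + 1 = 2 ^ L"
    using one_less_power[of "2::nat" L] assms by (simp_all add: N_def)
  define r where "r = (\<lambda>b j. vec (dim_col H) (\<lambda>k. \<Sum>t<L. of_bool (bit (j + 1 :: nat) t) * H $$ (b * L + t, k)))"
  have A: "?A = (\<lambda>i. r (i div N) (i mod N)) ` {..<N * q}"
    unfolding rows_def red_ext_def N_def[symmetric] q_def[symmetric]
    by (auto simp: r_def Let_def row_def atLeast0LessThan intro!: image_cong)
  show ?thesis
  proof (intro equalityI subsetI)
    fix v assume "v \<in> ?A"
    then obtain i where i: "i < N * q" "v = r (i div N) (i mod N)"
      unfolding A by auto
    define c :: "bit vec" where "c = vec L (\<lambda>t. of_bool (bit (i mod N + 1) t))"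
    have b: "i div N < q"
      using i(1) by (simp add: less_mult_imp_div_less mult.commute)
    have c_carrier: "c \<in> carrier_vec L" by (simp add: c_def)
    have "c \<noteq> 0\<^sub>v L"
    proof
      assume c: "c = 0\<^sub>v L"
      have "\<not> bit (i mod N + 1) t" for t
      proof (cases "t < L")
        case True
        then have "c $ t = 0" using c by simp
        with True show ?thesis by (simp add: c_def split: if_splits)
      next
        case False
        have "i mod N < N" using N by simp
        then have "i mod N + 1 < 2 ^ L" using N(2) by linarith
        also have "(2::nat) ^ L \<le> 2 ^ t" using False by simp
        finally show ?thesis by (simp add: bit_iff_odd)
      qed
      then have "i mod N + 1 = 0" by (intro bit_eqI) simp
      then show False by simp
    qed
    moreover have "v = vec (dim_col H) (\<lambda>k. \<Sum>t<L. c $ t * H $$ (i div N * L + t, k))"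
      unfolding i(2) r_def by (intro eq_vecI) (auto simp: c_def intro!: sum.cong)
    ultimately show "v \<in> ?B"
      using b c_carrier unfolding q_def by blast
  next
    fix v assume "v \<in> ?B"
    then obtain b c where bc: "b < q" "c \<in> carrier_vec L" "c \<noteq> 0\<^sub>v L"
      and v: "v = vec (dim_col H) (\<lambda>k. \<Sum>t<L. c $ t * H $$ (b * L + t, k))"
      unfolding q_def by auto
    define s :: nat where "s = horner_sum of_bool 2 (map (\<lambda>t. odd (c $ t)) [0..<L])"
    have s_bit: "bit s t \<longleftrightarrow> t < L \<and> odd (c $ t)" for t
      by (auto simp: s_def bit_horner_sum_bit_iff)
    have "s < 2 ^ L"
    proof -
      have "take_bit L s = s" by (rule bit_eqI) (auto simp: bit_take_bit_iff s_bit)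
      then show ?thesis by (simp add: take_bit_nat_eq_self_iff)
    qed
    obtain t where t: "t < L" "c $ t \<noteq> 0"
      using bc(2,3) by (metis carrier_vecD eq_vecI index_zero_vec)
    then have "bit s t" using s_bit by simp
    then have "s \<noteq> 0" by (metis bit_0_eq bot_apply bot_bool_def)
    define i where "i = b * N + (s - 1)"
    have s1: "s - 1 < N" using \<open>s < 2 ^ L\<close> \<open>s \<noteq> 0\<close> N(2) by linarith
    have di: "i div N = b" "i mod N = s - 1"
      using s1 N(1) by (simp_all add: i_def)
    have "i < N * q"
    proof -
      have "i < (b + 1) * N" using s1 by (simp add: i_def)
      also have "\<dots> \<le> q * N" using bc(1) by (intro mult_right_mono) auto
      finally show ?thesis by (simp add: mult.commute)
    qed
    moreover have "v = r (i div N) (i mod N)"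
      unfolding v r_def di using \<open>s \<noteq> 0\<close>
      by (intro eq_vecI) (auto simp: s_bit intro!: sum.cong)
    ultimately show "v \<in> ?A" unfolding A by auto
  qed
qed

definition avg_ss_count :: "nat \<Rightarrow> nat \<Rightarrow> nat \<Rightarrow> nat \<Rightarrow> real" where
  "avg_ss_count m n L w = (\<Sum>H\<in>carrier_mat m n. real (ss_count w (red_ext L H))) / 2 ^ (m * n)"


section \<open>Asymptotic growth rate and critical exponent\<close>

definition admissible_lengths :: "real \<Rightarrow> real \<Rightarrow> real \<Rightarrow> nat set" where
  "admissible_lengths R \<mu> l =
     {n. n > 0 \<and> (1 - R) * real n \<in> \<int> \<and> \<mu> * real n \<in> \<int> \<and> l * real n \<in> \<int>}"

text \<open>The floors are exact on the admissible lengths.\<close>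

definition normalized_log_ss :: "real \<Rightarrow> real \<Rightarrow> real \<Rightarrow> nat \<Rightarrow> real" where
  "normalized_log_ss R \<mu> l n =
     log 2 (avg_ss_count (nat \<lfloor>(1 - R) * real n\<rfloor>) n (nat \<lfloor>\<mu> * real n\<rfloor>) (nat \<lfloor>l * real n\<rfloor>)) / real n"

definition admissible_at_top :: "real \<Rightarrow> real \<Rightarrow> real \<Rightarrow> nat filter" where
  "admissible_at_top R \<mu> l = inf at_top (principal (admissible_lengths R \<mu> l))"

definition growth_rate :: "real \<Rightarrow> real \<Rightarrow> real \<Rightarrow> real" where
  "growth_rate R \<mu> l = Lim (admissible_at_top R \<mu> l) (normalized_log_ss R \<mu> l)"

definition critical_exponent :: "real \<Rightarrow> real \<Rightarrow> real" where
  "critical_exponent R \<mu> = Inf {l. l \<in> \<rat> \<and> 0 < l \<and> l \<le> 1 \<and> growth_rate R \<mu> l \<ge> 0}"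


section \<open>The bounds\<close>

text \<open>Since \<open>ln 0 = 0\<close>, the convention \<open>0 log 0 = 0\<close> is built in.\<close>

definition bin_entropy :: "real \<Rightarrow> real" where
  "bin_entropy x = - x * log 2 x - (1 - x) * log 2 (1 - x)"

text \<open>Solutions are sought in the domain \<open>{0..1}\<close> of the entropy function.\<close>

definition min_pos_solution :: "(real \<Rightarrow> real) \<Rightarrow> real" where
  "min_pos_solution f = (LEAST l. 0 < l \<and> l \<le> 1 \<and> f l = 0)"

definition alpha_L :: "real \<Rightarrow> real \<Rightarrow> real" where
  "alpha_L R \<mu> = min_pos_solution (\<lambda>l. bin_entropy l - (1 - R) * (1 - l / \<mu>))"

definition alpha_U :: "real \<Rightarrow> real \<Rightarrow> real" where
  "alpha_U R \<mu> = min_pos_solution (\<lambda>l. bin_entropy l - (1 - R))"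


text \<open>Under the standing assumptions on the parameters the two minima exist.\<close>

lemma min_pos_solution_works:
  fixes f :: "real \<Rightarrow> real"
  assumes cont: "continuous_on {0..1} f" and "f 0 < 0" and "0 \<le> c" "c \<le> 1" "f c \<ge> 0"
  shows "0 < min_pos_solution f" "min_pos_solution f \<le> 1" "f (min_pos_solution f) = 0"
    and "\<And>l. 0 < l \<Longrightarrow> l \<le> 1 \<Longrightarrow> f l = 0 \<Longrightarrow> min_pos_solution f \<le> l"
proof -
  define Z where "Z = {l \<in> {0..1}. f l = 0}"
  have Z_eq: "l \<in> Z \<longleftrightarrow> 0 < l \<and> l \<le> 1 \<and> f l = 0" for l
    using \<open>f 0 < 0\<close> by (cases "l = 0") (auto simp: Z_def)
  have "continuous_on {0..c} f"
    using cont by (rule continuous_on_subset) (use assms in auto)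
  then obtain z where z: "0 \<le> z" "z \<le> c" "f z = 0"
    using IVT'[of f 0 0 c] assms by auto
  then have "z \<in> Z" using assms by (simp add: Z_def)
  then have "Z \<noteq> {}" by blast
  have "closed Z"
  proof -
    have "closed (f -` {0} \<inter> {0..1})"
      using cont by (simp add: continuous_on_closed_vimage)
    also have "f -` {0} \<inter> {0..1} = Z" by (auto simp: Z_def)
    finally show ?thesis .
  qed
  have "compact Z"
  proof -
    have "{0..1} \<inter> Z = Z" by (auto simp: Z_def)
    then show ?thesis
      using compact_Int_closed[OF compact_Icc \<open>closed Z\<close>, of 0 1] by simp
  qed
  then obtain a where a: "a \<in> Z" "\<And>l. l \<in> Z \<Longrightarrow> a \<le> l"
    using compact_attains_inf[OF _ \<open>Z \<noteq> {}\<close>] by auto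
  have "min_pos_solution f = a"
    unfolding min_pos_solution_def by (rule Least_equality) (use a in \<open>auto simp: Z_eq\<close>)
  then show "0 < min_pos_solution f" "min_pos_solution f \<le> 1" "f (min_pos_solution f) = 0"
    and "\<And>l. 0 < l \<Longrightarrow> l \<le> 1 \<Longrightarrow> f l = 0 \<Longrightarrow> min_pos_solution f \<le> l"
    using a by (auto simp: Z_eq)
qed

lemma continuous_on_bin_entropy: "continuous_on {0..1} bin_entropy"
proof -
  have g: "continuous_on {0..1} (\<lambda>x::real. x * log 2 x)"
  proof (rule continuous_on_eq_continuous_within[THEN iffD2], rule ballI)
    fix x :: real assume x: "x \<in> {0..1}"
    show "continuous (at x within {0..1}) (\<lambda>x. x * log 2 x)"
    proof (cases "x = 0")
      case True
      have "((\<lambda>x::real. x * log 2 x) \<longlongrightarrow> 0) (at_right 0)"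
        by real_asymp
      moreover have "at (0::real) within {0..1} = at_right 0"
        by (rule at_within_Icc_at_right) simp
      ultimately show ?thesis using True by (simp add: continuous_within)
    next
      case False
      then have "isCont (\<lambda>x. x * log 2 x) x" using x by (auto intro!: continuous_intros)
      then show ?thesis by (rule continuous_at_imp_continuous_at_within)
    qed
  qed
  have "continuous_on {0..1} (\<lambda>x::real. (1 - x) * log 2 (1 - x))"
    using continuous_on_compose2[OF g, of "{0..1}" "\<lambda>x. 1 - x"] by (simp add: continuous_intros)
  then have "continuous_on {0..1} (\<lambda>x. - (x * log 2 x) - (1 - x) * log 2 (1 - x))"
    using g by (intro continuous_on_diff continuous_on_minus)
  also have "(\<lambda>x. - (x * log 2 x) - (1 - x) * log 2 (1 - x)) = bin_entropy"
    by (simp add: fun_eq_iff bin_entropy_def)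
  finally show ?thesis .
qed

lemma alpha_L_works:
  assumes "0 < R" "R < 1" "0 < \<mu>" "\<mu> \<le> 1 - R"
  shows "0 < alpha_L R \<mu>" "alpha_L R \<mu> \<le> 1"
    and "bin_entropy (alpha_L R \<mu>) - (1 - R) * (1 - alpha_L R \<mu> / \<mu>) = 0"
    and "\<And>l. 0 < l \<Longrightarrow> l \<le> 1 \<Longrightarrow> bin_entropy l - (1 - R) * (1 - l / \<mu>) = 0 \<Longrightarrow> alpha_L R \<mu> \<le> l"
proof -
  let ?f = "\<lambda>l. bin_entropy l - (1 - R) * (1 - l / \<mu>)"
  have cont: "continuous_on {0..1} ?f"
    by (intro continuous_on_diff continuous_on_mult continuous_on_divide continuous_on_bin_entropy
        continuous_on_const continuous_on_id) (use assms in auto)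
  have neg: "?f 0 < 0" using assms by (simp add: bin_entropy_def)
  have nonneg: "?f 1 \<ge> 0"
  proof -
    have "1 - 1 / \<mu> \<le> 0" using assms by (simp add: field_simps)
    with assms have "(1 - R) * (1 - 1 / \<mu>) \<le> 0" by (intro mult_nonneg_nonpos) auto
    then show ?thesis by (simp add: bin_entropy_def)
  qed
  show "0 < alpha_L R \<mu>" "alpha_L R \<mu> \<le> 1"
    and "bin_entropy (alpha_L R \<mu>) - (1 - R) * (1 - alpha_L R \<mu> / \<mu>) = 0"
    and "\<And>l. 0 < l \<Longrightarrow> l \<le> 1 \<Longrightarrow> bin_entropy l - (1 - R) * (1 - l / \<mu>) = 0 \<Longrightarrow> alpha_L R \<mu> \<le> l"
    unfolding alpha_L_def using min_pos_solution_works(1-3)[OF cont neg _ _ nonneg]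
      min_pos_solution_works(4)[OF cont neg _ _ nonneg] by auto
qed

lemma alpha_U_works:
  assumes "0 < R" "R < 1"
  shows "0 < alpha_U R \<mu>" "alpha_U R \<mu> \<le> 1"
    and "bin_entropy (alpha_U R \<mu>) - (1 - R) = 0"
    and "\<And>l. 0 < l \<Longrightarrow> l \<le> 1 \<Longrightarrow> bin_entropy l - (1 - R) = 0 \<Longrightarrow> alpha_U R \<mu> \<le> l"
proof -
  let ?f = "\<lambda>l. bin_entropy l - (1 - R)"
  have cont: "continuous_on {0..1} ?f"
    by (intro continuous_on_diff continuous_on_bin_entropy continuous_on_const)
  have neg: "?f 0 < 0" using assms by (simp add: bin_entropy_def)
  have nonneg: "?f (1 / 2) \<ge> 0"
    using assms by (simp add: bin_entropy_def log_divide)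
  show "0 < alpha_U R \<mu>" "alpha_U R \<mu> \<le> 1"
    and "bin_entropy (alpha_U R \<mu>) - (1 - R) = 0"
    and "\<And>l. 0 < l \<Longrightarrow> l \<le> 1 \<Longrightarrow> bin_entropy l - (1 - R) = 0 \<Longrightarrow> alpha_U R \<mu> \<le> l"
    unfolding alpha_U_def using min_pos_solution_works(1-3)[OF cont neg _ _ nonneg]
      min_pos_solution_works(4)[OF cont neg _ _ nonneg] by auto
qed

end

theory Submission
  imports Defs
begin

text \<open>
  Fix \<open>x\<close> of weight \<open>w > 0\<close>. If all rows of \<open>H\<close> are orthogonal to \<open>x\<close> over \<open>F\<^sub>2\<close>, then so are all
  their combinations and \<open>x\<close> is a stopping set vector; this happens with probability \<open>2 ^ (- m)\<close>.
  Conversely, if \<open>x\<close> is a stopping set vector, then in each block the span of the rows restricted to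
  the support of \<open>x\<close> misses a unit vector, so by duality all \<open>L\<close> rows of the block are orthogonal to
  one of the fewer than \<open>2 ^ w\<close> nonzero vectors supported there. A union bound over the choices of
  one such vector per block gives probability at most \<open>2 ^ (w * m / L - m)\<close>. As
  \<open>n choose (l * n)\<close> is \<open>2 ^ (n * H l)\<close> up to a factor \<open>n + 1\<close>, the growth rate at \<open>l\<close> lies between
  \<open>H l - (1 - R)\<close> and \<open>H l - (1 - R) * (1 - l / \<mu>)\<close>. A nonnegative growth rate at \<open>l\<close> thus forces a
  zero of the upper bound in \<open>(0, l]\<close>, and, \<open>H\<close> being increasing on \<open>(0, 1/2]\<close>, the lower bound
  is nonnegative just to the right of \<open>alpha_U\<close>.
\<close>

text \<open>By default the simplifier turns sums and products of bits into XOR and AND, which hides the field structure.\<close>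

declare add_bit_eq_xor [simp del] mult_bit_eq_and [simp del]

section \<open>Counting binary vectors and matrices\<close>

lemma bit_zero_or_one: "(a::bit) = 0 \<or> a = 1"
  by (cases a) auto

lemma bit_add_self: "a + a = (0::bit)"
  by (cases a) auto

text \<open>Passing to supports identifies binary vectors with subsets of \<open>{..<n}\<close>; the
  next count uses the same bijection.\<close>

lemma card_weight_vecs: "card {x \<in> carrier_vec n. hamming_weight x = w} = n choose w"
proof -
  have "bij_betw (\<lambda>x::bit vec. {i. i < dim_vec x \<and> x $ i = 1})
    {x \<in> carrier_vec n. hamming_weight x = w} {B. B \<subseteq> {..<n} \<and> card B = w}"
  proof (rule bij_betw_byWitness[where f' = "\<lambda>B. vec n (\<lambda>i. of_bool (i \<in> B))"])
    show "\<forall>x\<in>{x \<in> carrier_vec n. hamming_weight x = w}.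
        vec n (\<lambda>i. of_bool (i \<in> {i. i < dim_vec x \<and> x $ i = 1})) = (x :: bit vec)"
      by (auto intro!: eq_vecI)
    show "\<forall>B\<in>{B. B \<subseteq> {..<n} \<and> card B = w}.
        {i. i < dim_vec (vec n (\<lambda>i. of_bool (i \<in> B))) \<and> vec n (\<lambda>i. of_bool (i \<in> B)) $ i = (1 :: bit)} = B"
      by auto
    show "(\<lambda>x::bit vec. {i. i < dim_vec x \<and> x $ i = 1}) ` {x \<in> carrier_vec n. hamming_weight x = w}
        \<subseteq> {B. B \<subseteq> {..<n} \<and> card B = w}"
      by (auto simp: hamming_weight_def)
    show "(\<lambda>B. vec n (\<lambda>i. of_bool (i \<in> B))) ` {B. B \<subseteq> {..<n} \<and> card B = w}
        \<subseteq> {x \<in> carrier_vec n. hamming_weight x = w}"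
    proof (intro image_subsetI CollectI conjI)
      fix B assume B: "B \<in> {B. B \<subseteq> {..<n} \<and> card B = w}"
      then have "{i. i < n \<and> vec n (\<lambda>i. of_bool (i \<in> B)) $ i = (1 :: bit)} = B" by auto
      with B show "hamming_weight (vec n (\<lambda>i. of_bool (i \<in> B))) = w"
        by (simp add: hamming_weight_def)
    qed simp
  qed
  then show ?thesis
    by (simp add: bij_betw_same_card n_subsets)
qed

lemma card_supported_vecs:
  assumes "x \<in> carrier_vec n"
  shows "card {y \<in> carrier_vec n. \<forall>i<n. y $ i = (1::bit) \<longrightarrow> x $ i = (1::bit)} = 2 ^ hamming_weight x"
    and "finite {y \<in> carrier_vec n. \<forall>i<n. y $ i = (1::bit) \<longrightarrow> x $ i = (1::bit)}"
proof -
  let ?T = "{i. i < dim_vec x \<and> x $ i = 1}"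
  have bij: "bij_betw (\<lambda>y::bit vec. {i. i < dim_vec y \<and> y $ i = 1})
    {y \<in> carrier_vec n. \<forall>i<n. y $ i = 1 \<longrightarrow> x $ i = 1} (Pow ?T)"
  proof (rule bij_betw_byWitness[where f' = "\<lambda>B. vec n (\<lambda>i. of_bool (i \<in> B))"])
    show "\<forall>y\<in>{y \<in> carrier_vec n. \<forall>i<n. y $ i = 1 \<longrightarrow> x $ i = 1}.
        vec n (\<lambda>i. of_bool (i \<in> {i. i < dim_vec y \<and> y $ i = 1})) = (y :: bit vec)"
      by (auto intro!: eq_vecI)
    show "\<forall>B\<in>Pow ?T.
        {i. i < dim_vec (vec n (\<lambda>i. of_bool (i \<in> B))) \<and> vec n (\<lambda>i. of_bool (i \<in> B)) $ i = (1 :: bit)} = B"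
      using assms by auto
  qed (use assms in auto)
  have "card (Pow ?T) = 2 ^ hamming_weight x"
    by (simp add: card_Pow hamming_weight_def)
  with bij show "card {y \<in> carrier_vec n. \<forall>i<n. y $ i = (1::bit) \<longrightarrow> x $ i = (1::bit)} = 2 ^ hamming_weight x"
    by (metis (no_types, lifting) bij_betw_same_card)
  show "finite {y \<in> carrier_vec n. \<forall>i<n. y $ i = (1::bit) \<longrightarrow> x $ i = (1::bit)}"
    using bij by (simp add: bij_betw_finite)
qed

lemma card_carrier_vec_bit: "card (carrier_vec n :: bit vec set) = 2 ^ n"
  and finite_carrier_vec_bit: "finite (carrier_vec n :: bit vec set)"
proof -
  \<comment> \<open>For the all-one vector the support condition is vacuous, so the previous count
    applies with weight \<open>n\<close>.\<close>
  have *: "{y \<in> carrier_vec n. \<forall>i<n. y $ i = (1::bit) \<longrightarrow> vec n (\<lambda>_. 1) $ i = (1::bit)} = carrier_vec n"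
    by auto
  have "{i. i < n \<and> vec n (\<lambda>_. 1) $ i = (1::bit)} = {..<n}"
    by auto
  then have "hamming_weight (vec n (\<lambda>_. 1)) = n"
    by (simp add: hamming_weight_def)
  then show "card (carrier_vec n :: bit vec set) = 2 ^ n" "finite (carrier_vec n :: bit vec set)"
    using card_supported_vecs[of "vec n (\<lambda>_. 1)" n] unfolding * by simp_all
qed

text \<open>Adding the unit vector at a coordinate where \<open>y\<close> is 1 flips the product
  with \<open>y\<close>, so the two values 0 and 1 are taken equally often.\<close>

lemma card_orthogonal_vecs:
  assumes y: "y \<in> carrier_vec n" "y \<noteq> 0\<^sub>v n"
  shows "card {v \<in> carrier_vec n. (v::bit vec) \<bullet> y = 0} = 2 ^ (n - 1)"
proof -
  obtain j where j: "j < n" "y $ j = 1"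
    using y by (metis bit_zero_or_one carrier_vecD eq_vecI index_zero_vec)
  let ?u = "unit_vec n j :: bit vec"
  let ?A = "\<lambda>a. {v \<in> carrier_vec n. (v::bit vec) \<bullet> y = a}"
  have uy: "?u \<bullet> y = 1" using j y by simp
  have uu: "v + ?u + ?u = v" if "v \<in> carrier_vec n" for v
    using that by (intro eq_vecI) (auto simp: unit_vec_def add.assoc)
  have bij: "bij_betw (\<lambda>v. v + ?u) (?A 0) (?A 1)"
  proof (rule bij_betw_byWitness[where f' = "\<lambda>v. v + ?u"])
  qed (use y uu uy in \<open>auto simp: add_scalar_prod_distrib[of _ n]\<close>)
  have "carrier_vec n = ?A 0 \<union> ?A 1" using bit_zero_or_one by auto
  moreover have "card (?A 0 \<union> ?A 1) = card (?A 0) + card (?A 1)"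
    by (rule card_Un_disjoint) (auto intro: finite_subset[OF _ finite_carrier_vec_bit])
  ultimately have "2 ^ n = 2 * card (?A 0)"
    using bij_betw_same_card[OF bij] card_carrier_vec_bit[of n] by simp
  with j show ?thesis by (cases n) auto
qed

text \<open>A matrix is an independent choice of rows, so matrices with rowwise conditions can be
  counted by a product.\<close>

lemma bij_betw_rows:
  "bij_betw (\<lambda>H. \<lambda>i\<in>{..<m}. row H i) (carrier_mat m n :: 'a mat set) ({..<m} \<rightarrow>\<^sub>E carrier_vec n)"
proof (rule bij_betw_byWitness[where f' = "\<lambda>f. mat m n (\<lambda>(i, k). f i $ k)"])
  show "\<forall>f\<in>{..<m} \<rightarrow>\<^sub>E (carrier_vec n :: 'a vec set). (\<lambda>i\<in>{..<m}. row (mat m n (\<lambda>(i, k). f i $ k)) i) = f"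
  proof
    fix f :: "nat \<Rightarrow> 'a vec" assume f: "f \<in> {..<m} \<rightarrow>\<^sub>E carrier_vec n"
    show "(\<lambda>i\<in>{..<m}. row (mat m n (\<lambda>(i, k). f i $ k)) i) = f"
    proof
      fix i
      show "(\<lambda>i\<in>{..<m}. row (mat m n (\<lambda>(i, k). f i $ k)) i) i = f i"
      proof (cases "i < m")
        case True
        with f have "f i \<in> carrier_vec n" by auto
        with True show ?thesis by (auto intro!: eq_vecI)
      next
        case False
        with f show ?thesis by (auto simp: PiE_def extensional_def)
      qed
    qed
  qed
  show "\<forall>H\<in>carrier_mat m n. mat m n (\<lambda>(i, k). (\<lambda>i\<in>{..<m}. row H i) i $ k) = (H :: 'a mat)"
    by (intro ballI eq_matI) auto
  show "(\<lambda>H. \<lambda>i\<in>{..<m}. row H i) ` (carrier_mat m n :: 'a mat set) \<subseteq> {..<m} \<rightarrow>\<^sub>E carrier_vec n"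
  proof (rule image_subsetI)
    fix H :: "'a mat" assume H: "H \<in> carrier_mat m n"
    have "row H i \<in> carrier_vec n" for i
      using H by (intro carrier_vecI) simp
    then show "(\<lambda>i\<in>{..<m}. row H i) \<in> {..<m} \<rightarrow>\<^sub>E carrier_vec n"
      by (intro PiE_I) (simp_all only: lessThan_iff restrict_apply' restrict_apply if_True if_False)
  qed
  show "(\<lambda>f. mat m n (\<lambda>(i, k). f i $ k)) ` ({..<m} \<rightarrow>\<^sub>E (carrier_vec n :: 'a vec set)) \<subseteq> carrier_mat m n"
    by (rule image_subsetI) (rule mat_carrier)
qed

text \<open>Each row condition halves the choices for its row, independently of the others.
  \<open>Y\<close> may vary with the row because the union bound later picks one vector per
  block.\<close>

lemma card_orthogonal_mats:
  assumes Y: "\<And>i. i < m \<Longrightarrow> Y i \<in> carrier_vec n \<and> Y i \<noteq> 0\<^sub>v n"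
  shows "card {H \<in> carrier_mat m n. \<forall>i<m. row H i \<bullet> Y i = (0::bit)} = 2 ^ ((n - 1) * m)"
proof -
  let ?F = "PiE {..<m} (\<lambda>i. {v \<in> carrier_vec n. v \<bullet> Y i = (0::bit)})"
  have "bij_betw (\<lambda>H. \<lambda>i\<in>{..<m}. row H i)
      {H \<in> carrier_mat m n. \<forall>i<m. row H i \<bullet> Y i = (0::bit)} ?F"
  proof (rule bij_betw_subset[OF bij_betw_rows])
    show "(\<lambda>H. \<lambda>i\<in>{..<m}. row H i) ` {H \<in> carrier_mat m n. \<forall>i<m. row H i \<bullet> Y i = 0} = ?F"
    proof (intro equalityI subsetI)
      fix f assume f: "f \<in> ?F"
      then have "f \<in> {..<m} \<rightarrow>\<^sub>E carrier_vec n" by (auto simp: PiE_iff)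
      then obtain H where H: "H \<in> carrier_mat m n" "f = (\<lambda>i\<in>{..<m}. row H i)"
        using bij_betw_imp_surj_on[OF bij_betw_rows] by blast
      with f show "f \<in> (\<lambda>H. \<lambda>i\<in>{..<m}. row H i) ` {H \<in> carrier_mat m n. \<forall>i<m. row H i \<bullet> Y i = 0}"
        by (auto simp: PiE_iff)
    qed (auto simp: PiE_iff)
  qed auto
  then have "card {H \<in> carrier_mat m n. \<forall>i<m. row H i \<bullet> Y i = (0::bit)} = card ?F"
    by (rule bij_betw_same_card)
  also have "\<dots> = (\<Prod>i<m. 2 ^ (n - 1))"
    using Y by (simp add: card_PiE card_orthogonal_vecs)
  finally show ?thesis by (simp add: power_mult)
qed

lemma finite_carrier_mat_bit: "finite (carrier_mat m n :: bit mat set)"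
  by (rule bij_betw_finite[OF bij_betw_rows, THEN iffD2]) (intro finite_PiE finite_lessThan finite_carrier_vec_bit)

text \<open>
  If neither \<open>u\<close> nor \<open>u\<close> plus the last row lies in the span of the first \<open>L\<close> rows, the two
  separating functionals given by the induction hypothesis, or their sum, separate \<open>u\<close> from all rows.
\<close>

lemma span_or_separating:
  fixes r :: "nat \<Rightarrow> nat \<Rightarrow> bit"
  shows "(\<exists>c. \<forall>k<n. u k = (\<Sum>t<L. c t * r t k)) \<or>
    (\<exists>y. (\<forall>t<L. (\<Sum>k<n. y k * r t k) = 0) \<and> (\<Sum>k<n. y k * u k) = 1)"
proof (induction L arbitrary: u)
  case 0
  show ?case
  proof (cases "\<forall>k<n. u k = 0")
    case False
    then obtain j where j: "j < n" "u j = 1" using bit_zero_or_one by blast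
    have "(\<Sum>k<n. (if k = j then 1 else 0) * u k) = (\<Sum>k<n. if k = j then u k else 0)"
      by (intro sum.cong) auto
    also have "\<dots> = 1" using j by simp
    finally show ?thesis by (intro disjI2 exI[of _ "\<lambda>k. if k = j then 1 else 0"]) simp
  qed simp
next
  case (Suc L)
  let ?orth = "\<lambda>y. \<forall>t<L. (\<Sum>k<n. y k * r t k) = 0"
  \<comment> \<open>In characteristic 2, \<open>a * r L k\<close> can be moved to the other side
    unchanged, where \<open>a\<close> becomes the coefficient of the last row.\<close>
  have ext: ?case if "\<forall>k<n. u k + a * r L k = (\<Sum>t<L. c t * r t k)" for a c
  proof -
    have "u k = (\<Sum>t<Suc L. (c(L := a)) t * r t k)" if k: "k < n" for k
    proof -
      have "(\<Sum>t<L. (c(L := a)) t * r t k) = (\<Sum>t<L. c t * r t k)"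
        by (intro sum.cong) auto
      then show ?thesis using k \<open>\<forall>k<n. u k + a * r L k = _\<close>[rule_format, OF k, symmetric]
        by (simp add: add.assoc bit_add_self)
    qed
    then show ?thesis by blast
  qed
  have sep: ?case if "?orth y" "(\<Sum>k<n. y k * r L k) = 0" "(\<Sum>k<n. y k * u k) = 1" for y
    using that by (auto simp: less_Suc_eq)
  consider c where "\<forall>k<n. u k + 0 * r L k = (\<Sum>t<L. c t * r t k)"
    | c where "\<forall>k<n. u k + 1 * r L k = (\<Sum>t<L. c t * r t k)"
    | y z where "?orth y" "(\<Sum>k<n. y k * u k) = 1" "?orth z" "(\<Sum>k<n. z k * (u k + r L k)) = 1"
    using Suc.IH[of u] Suc.IH[of "\<lambda>k. u k + r L k"] by auto
  then show ?case
  proof cases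
    case 3
    have yz: "?orth (\<lambda>k. y k + z k)"
      using 3 by (simp add: distrib_right sum.distrib)
    have z: "(\<Sum>k<n. z k * u k) + (\<Sum>k<n. z k * r L k) = 1"
      using 3 by (simp add: distrib_left sum.distrib)
    show ?thesis
    proof (cases "(\<Sum>k<n. y k * r L k) = 0 \<or> (\<Sum>k<n. z k * r L k) = 0")
      case True
      then show ?thesis using sep[of y] sep[of z] 3 z by auto
    next
      case False
      \<comment> \<open>Here \<open>z\<close> vanishes on \<open>u\<close>, so \<open>y + z\<close>
        takes the value 1 on \<open>u\<close> and 1 + 1 = 0 on the last row.\<close>
      then have "(\<Sum>k<n. y k * r L k) = 1" "(\<Sum>k<n. z k * r L k) = 1" using bit_zero_or_one by blast+
      with z 3 show ?thesis
        by (intro sep[OF yz]) (auto simp: distrib_right sum.distrib)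
    qed
  qed (erule ext)+
qed

subsection \<open>Stopping sets of the redundant extension\<close>

text \<open>Reduction modulo 2. An integer product equal to 1 thus forces a nonzero product over
  \<open>F\<^sub>2\<close>; the converse fails, since 3 is odd too.\<close>

lemma of_int_int_ip:
  assumes "dim_vec h = dim_vec x"
  shows "of_int (int_ip h x) = h \<bullet> x"
proof -
  have *: "of_int (of_bit a) = a" for a by (cases a) auto
  show ?thesis
    unfolding int_ip_def scalar_prod_def of_int_sum of_int_mult * atLeast0LessThan ..
qed

text \<open>Replaces the binary enumeration of rows by blocks \<open>b\<close> and coefficient
  vectors \<open>c\<close>; \<open>q\<close> is the number of blocks.\<close>

lemma stopping_set_vec_red_ext_iff:
  assumes "H \<in> carrier_mat (q * L) n" "L > 0" "x \<in> carrier_vec n"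
  shows "stopping_set_vec (red_ext L H) x \<longleftrightarrow> (\<forall>b<q. \<forall>c\<in>carrier_vec L. c \<noteq> 0\<^sub>v L \<longrightarrow>
    int_ip (vec n (\<lambda>k. \<Sum>t<L. c $ t * H $$ (b * L + t, k))) x \<noteq> 1)"
proof -
  have dims: "dim_col (red_ext L H) = n" "dim_row H div L = q" "dim_col H = n"
    using assms by (auto simp: red_ext_def)
  have "(\<forall>i<dim_row M. int_ip (row M i) x \<noteq> 1) \<longleftrightarrow> (\<forall>v\<in>set (rows M). int_ip v x \<noteq> 1)" for M
    by (auto simp: rows_def)
  then have "stopping_set_vec (red_ext L H) x \<longleftrightarrow> (\<forall>v\<in>set (rows (red_ext L H)). int_ip v x \<noteq> 1)"
    using assms(3) by (simp add: stopping_set_vec_def dims)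
  then show ?thesis
    unfolding set_rows_red_ext[OF \<open>L > 0\<close>] dims by auto
qed

lemma block_index_less:
  assumes "b < q" "t < L"
  shows "b * L + t < q * (L::nat)"
proof -
  have "b * L + t < (b + 1) * L" using assms by simp
  also have "\<dots> \<le> q * L" using assms by (intro mult_right_mono) auto
  finally show ?thesis .
qed

text \<open>All combinations of the rows have even integer product with \<open>x\<close>, hence
  never 1.\<close>

lemma stopping_set_vec_if_orthogonal:
  assumes H: "H \<in> carrier_mat (q * L) n" and "L > 0" and x: "x \<in> carrier_vec n"
    and orth: "\<forall>i<q * L. row H i \<bullet> x = 0"
  shows "stopping_set_vec (red_ext L H) x"
  unfolding stopping_set_vec_red_ext_iff[OF assms(1-3)]
proof (intro allI ballI impI notI)
  fix b c assume b: "b < q" and one: "int_ip (vec n (\<lambda>k. \<Sum>t<L. c $ t * H $$ (b * L + t, k))) x = 1"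
  have "of_int (int_ip (vec n (\<lambda>k. \<Sum>t<L. c $ t * H $$ (b * L + t, k))) x)
      = (\<Sum>k<n. \<Sum>t<L. c $ t * (H $$ (b * L + t, k) * x $ k))"
    using x by (simp add: of_int_int_ip scalar_prod_def sum_distrib_right mult.assoc atLeast0LessThan)
  also have "\<dots> = (\<Sum>t<L. c $ t * (\<Sum>k<n. H $$ (b * L + t, k) * x $ k))"
    by (subst sum.swap) (simp add: sum_distrib_left)
  also have "\<dots> = (\<Sum>t<L. c $ t * (row H (b * L + t) \<bullet> x))"
    using H x block_index_less[OF b] by (intro sum.cong) (auto simp: scalar_prod_def atLeast0LessThan)
  also have "\<dots> = 0"
    using orth block_index_less[OF b] by simp
  finally show False using one by simp
qed

text \<open>Were a unit vector at a support position \<open>j\<close> spanned by the block rows cut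
  down to the support of \<open>x\<close>, the same combination of the full rows would meet
  \<open>x\<close> exactly once. So a functional separates it from them, and the part of that
  functional on the support is the required vector.\<close>

lemma block_orthogonal_if_stopping_set_vec:
  assumes H: "H \<in> carrier_mat (q * L) n" and "L > 0" and x: "x \<in> carrier_vec n"
    and stop: "stopping_set_vec (red_ext L H) x" and w: "hamming_weight x > 0" and b: "b < q"
  shows "\<exists>y\<in>carrier_vec n. y \<noteq> 0\<^sub>v n \<and> (\<forall>i<n. y $ i = 1 \<longrightarrow> x $ i = 1) \<and>
    (\<forall>t<L. row H (b * L + t) \<bullet> y = 0)"
proof -
  have "{i. i < dim_vec x \<and> x $ i = 1} \<noteq> {}"
    using w unfolding hamming_weight_def by (metis card.empty less_irrefl)
  then obtain j where j: "j < n" "x $ j = 1" using x by auto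
  let ?e = "\<lambda>k. if k = j then 1 else 0 :: bit"
  consider (span) c where "\<forall>k<n. ?e k = (\<Sum>t<L. c t * (H $$ (b * L + t, k) * x $ k))"
    | (sep) y where "\<forall>t<L. (\<Sum>k<n. y k * (H $$ (b * L + t, k) * x $ k)) = 0" "(\<Sum>k<n. y k * ?e k) = 1"
    using span_or_separating[where n = n and u = ?e and L = L and r = "\<lambda>t k. H $$ (b * L + t, k) * x $ k"] by auto
  then show ?thesis
  proof cases
    case span
    define d where "d = vec L c"
    let ?h = "\<lambda>k. \<Sum>t<L. d $ t * H $$ (b * L + t, k)"
    have h: "?h k * x $ k = ?e k" if "k < n" for k
      using span that by (simp add: d_def sum_distrib_right mult.assoc)
    have "d \<noteq> 0\<^sub>v L"
    proof
      assume "d = 0\<^sub>v L"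
      then have "?h j = 0" by simp
      with h[OF j(1)] show False by simp
    qed
    moreover have "int_ip (vec n ?h) x = 1"
    proof -
      \<comment> \<open>Termwise, the integer product counts the \<open>k\<close> with
        \<open>?h k * x $ k = 1\<close>, and only \<open>j\<close> is such.\<close>
      have of_mult: "of_bit u * of_bit v = (of_bit (u * v) :: int)" for u v
        by (cases u; cases v) auto
      have "int_ip (vec n ?h) x = (\<Sum>k<n. of_bit (?h k * x $ k))"
        unfolding int_ip_def of_mult using x by (intro sum.cong) auto
      also have "\<dots> = (\<Sum>k<n. if k = j then 1 else 0)"
        using h by (intro sum.cong) auto
      finally show ?thesis using j by simp
    qed
    moreover have "d \<in> carrier_vec L" by (simp add: d_def)
    ultimately show ?thesis
      using stop b unfolding stopping_set_vec_red_ext_iff[OF assms(1-3)] by blast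
  next
    case sep
    have "(\<Sum>k<n. y k * ?e k) = (\<Sum>k<n. if k = j then y k else 0)"
      by (intro sum.cong) auto
    then have yj: "y j = 1" using sep j by simp
    \<comment> \<open>Moving the factor \<open>x $ k\<close> from the rows to \<open>y\<close> keeps
      all products and puts the vector inside the support of \<open>x\<close>.\<close>
    define z where "z = vec n (\<lambda>k. y k * x $ k)"
    have z1: "z $ j = 1" using yj j by (simp add: z_def)
    have "z \<noteq> 0\<^sub>v n"
    proof
      assume "z = 0\<^sub>v n"
      with z1 j show False by simp
    qed
    moreover have "row H (b * L + t) \<bullet> z = 0" if t: "t < L" for t
    proof -
      have "row H (b * L + t) \<bullet> z = (\<Sum>k<n. y k * (H $$ (b * L + t, k) * x $ k))"
        using H block_index_less[OF b t]
        by (auto simp: scalar_prod_def z_def atLeast0LessThan mult.left_commute intro!: sum.cong)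
      with sep t show ?thesis by simp
    qed
    moreover have "\<forall>i<n. z $ i = 1 \<longrightarrow> x $ i = 1"
    proof (intro allI impI)
      fix i assume "i < n" "z $ i = 1"
      then have "y i * x $ i = 1" by (simp add: z_def)
      then show "x $ i = 1" using bit_zero_or_one[of "x $ i"] by auto
    qed
    ultimately show ?thesis
      by (intro bexI[of _ z]) (auto simp: z_def)
  qed
qed

section \<open>Matrices for which a fixed vector is stopping\<close>

lemma card_stopping_ge:
  assumes "L > 0" "x \<in> carrier_vec n" "hamming_weight x > 0"
  shows "2 ^ ((n - 1) * (q * L)) \<le> card {H \<in> carrier_mat (q * L) n. stopping_set_vec (red_ext L H) x}"
proof -
  have "x \<noteq> 0\<^sub>v n"
  proof
    assume "x = 0\<^sub>v n"
    then have "{i. i < dim_vec x \<and> x $ i = 1} = {}" by auto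
    with assms(3) show False unfolding hamming_weight_def by (metis card.empty less_irrefl)
  qed
  then have "2 ^ ((n - 1) * (q * L)) = card {H \<in> carrier_mat (q * L) n. \<forall>i<q * L. row H i \<bullet> x = 0}"
    using assms card_orthogonal_mats[of "q * L" "\<lambda>_. x" n] by simp
  also have "\<dots> \<le> card {H \<in> carrier_mat (q * L) n. stopping_set_vec (red_ext L H) x}"
    using assms stopping_set_vec_if_orthogonal
    by (intro card_mono) (auto intro: finite_subset[OF _ finite_carrier_mat_bit])
  finally show ?thesis .
qed

text \<open>Union bound: \<open>C Y\<close> holds the matrices whose block \<open>b\<close> is
  orthogonal to \<open>Y b\<close>, and there are at most \<open>2 ^ (hamming_weight x * q)\<close>
  choices of \<open>Y\<close>.\<close>

lemma card_stopping_le: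
  assumes "L > 0" and x: "x \<in> carrier_vec n" "hamming_weight x > 0"
  shows "card {H \<in> carrier_mat (q * L) n. stopping_set_vec (red_ext L H) x}
    \<le> 2 ^ (hamming_weight x * q) * 2 ^ ((n - 1) * (q * L))"
proof -
  let ?supp = "{y \<in> carrier_vec n. \<forall>i<n. y $ i = (1::bit) \<longrightarrow> x $ i = 1}"
  define S where "S = {y \<in> ?supp. y \<noteq> 0\<^sub>v n}"
  define C where "C = (\<lambda>Y :: nat \<Rightarrow> bit vec. {H \<in> carrier_mat (q * L) n. \<forall>i<q * L. row H i \<bullet> (Y (i div L)) = 0})"
  have S: "finite S" "card S \<le> 2 ^ hamming_weight x"
    using card_supported_vecs[OF x(1)] card_mono[of ?supp S] finite_subset[of S ?supp]
    by (auto simp: S_def)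
  have "{H \<in> carrier_mat (q * L) n. stopping_set_vec (red_ext L H) x} \<subseteq> (\<Union>Y\<in>{..<q} \<rightarrow>\<^sub>E S. C Y)"
  proof
    fix H assume H: "H \<in> {H \<in> carrier_mat (q * L) n. stopping_set_vec (red_ext L H) x}"
    have "\<forall>b\<in>{..<q}. \<exists>y. y \<in> S \<and> (\<forall>t<L. row H (b * L + t) \<bullet> y = 0)"
    proof
      fix b assume "b \<in> {..<q}"
      with H obtain y where "y \<in> carrier_vec n" "y \<noteq> 0\<^sub>v n" "\<forall>i<n. y $ i = 1 \<longrightarrow> x $ i = 1"
          "\<forall>t<L. row H (b * L + t) \<bullet> y = 0"
        using block_orthogonal_if_stopping_set_vec[OF _ assms(1,2) _ assms(3), of H q b] by blast
      then show "\<exists>y. y \<in> S \<and> (\<forall>t<L. row H (b * L + t) \<bullet> y = 0)"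
        unfolding S_def by blast
    qed
    then obtain Y where Y: "\<forall>b\<in>{..<q}. Y b \<in> S \<and> (\<forall>t<L. row H (b * L + t) \<bullet> Y b = 0)"
      by (rule bchoice[THEN exE])
    \<comment> \<open>Row \<open>i\<close> is row \<open>i mod L\<close> of block
      \<open>i div L\<close>.\<close>
    have "row H i \<bullet> Y (i div L) = 0" if "i < q * L" for i
    proof -
      have "i div L < q" using that by (simp add: less_mult_imp_div_less)
      moreover have "i mod L < L" using \<open>L > 0\<close> by simp
      ultimately have "row H (i div L * L + i mod L) \<bullet> Y (i div L) = 0" using Y by blast
      then show ?thesis by simp
    qed
    \<comment> \<open>Restricting the choice function places it in the finite index set of the
      union.\<close>
    then have "H \<in> C (restrict Y {..<q})"
      using H by (auto simp: C_def less_mult_imp_div_less)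
    moreover have "restrict Y {..<q} \<in> {..<q} \<rightarrow>\<^sub>E S" using Y by auto
    ultimately show "H \<in> (\<Union>Y\<in>{..<q} \<rightarrow>\<^sub>E S. C Y)" by blast
  qed
  moreover have finC: "finite (C Y)" for Y
    by (auto simp: C_def intro: finite_subset[OF _ finite_carrier_mat_bit])
  ultimately have "card {H \<in> carrier_mat (q * L) n. stopping_set_vec (red_ext L H) x}
      \<le> card (\<Union>Y\<in>{..<q} \<rightarrow>\<^sub>E S. C Y)"
    using S by (intro card_mono) (auto intro!: finite_PiE)
  also have "\<dots> \<le> (\<Sum>Y\<in>{..<q} \<rightarrow>\<^sub>E S. card (C Y))"
    using S by (intro card_UN_le finite_PiE) auto
  also have "\<dots> = (\<Sum>Y\<in>{..<q} \<rightarrow>\<^sub>E S. 2 ^ ((n - 1) * (q * L)))"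
    unfolding C_def
  proof (intro sum.cong refl card_orthogonal_mats)
    fix Y i assume Y: "Y \<in> {..<q} \<rightarrow>\<^sub>E S" and "i < q * L"
    then have "i div L \<in> {..<q}" by (simp add: less_mult_imp_div_less)
    with Y have "Y (i div L) \<in> S" by (rule PiE_mem)
    then show "Y (i div L) \<in> carrier_vec n \<and> Y (i div L) \<noteq> 0\<^sub>v n" by (simp add: S_def)
  qed
  also have "\<dots> = card S ^ q * 2 ^ ((n - 1) * (q * L))"
    by (simp add: card_PiE)
  also have "\<dots> \<le> (2 ^ hamming_weight x) ^ q * 2 ^ ((n - 1) * (q * L))"
    using S by (intro mult_right_mono power_mono) auto
  finally show ?thesis by (simp add: power_mult)
qed

section \<open>Averaging over the ensemble\<close>

text \<open>Double counting of pairs of a matrix and a stopping vector, so that bounds for a single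
  vector can be summed.\<close>

lemma avg_ss_count_alt:
  "avg_ss_count m n L w = (\<Sum>x\<in>{x \<in> carrier_vec n. hamming_weight x = w}.
    real (card {H \<in> carrier_mat m n. stopping_set_vec (red_ext L H) x})) / 2 ^ (m * n)"
proof -
  let ?X = "{x \<in> carrier_vec n. hamming_weight x = w}"
  have finX: "finite ?X" by (auto intro: finite_subset[OF _ finite_carrier_vec_bit])
  have "real (ss_count w (red_ext L H)) = (\<Sum>x\<in>?X. of_bool (stopping_set_vec (red_ext L H) x))"
    if "H \<in> carrier_mat m n" for H
  proof -
    have "{x. stopping_set_vec (red_ext L H) x \<and> hamming_weight x = w} = ?X \<inter> {x. stopping_set_vec (red_ext L H) x}"
      using that by (auto simp: stopping_set_vec_def red_ext_def)
    then show ?thesis using finX by (simp add: ss_count_def sum_of_bool_eq)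
  qed
  then have "(\<Sum>H\<in>carrier_mat m n. real (ss_count w (red_ext L H)))
      = (\<Sum>x\<in>?X. \<Sum>H\<in>carrier_mat m n. of_bool (stopping_set_vec (red_ext L H) x))"
    by (subst sum.swap) simp
  also have "\<dots> = (\<Sum>x\<in>?X. real (card {H \<in> carrier_mat m n. stopping_set_vec (red_ext L H) x}))"
    by (intro sum.cong refl) (simp add: sum_of_bool_eq finite_carrier_mat_bit Collect_conj_eq)
  finally show ?thesis by (simp add: avg_ss_count_def)
qed

lemma avg_ss_count_bounds:
  assumes "L > 0" "w > 0" "n > 0"
  shows "real (n choose w) / 2 ^ (q * L) \<le> avg_ss_count (q * L) n L w"
    and "avg_ss_count (q * L) n L w \<le> real (n choose w) * 2 ^ (w * q) / 2 ^ (q * L)"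
proof -
  let ?X = "{x \<in> carrier_vec n. hamming_weight x = w}"
  let ?c = "\<lambda>x. real (card {H \<in> carrier_mat (q * L) n. stopping_set_vec (red_ext L H) x})"
  \<comment> \<open>With \<open>n - 1 = k\<close>, the quotient of
    \<open>2 ^ ((n - 1) * (q * L))\<close> by the number of matrices simplifies to
    \<open>1 / 2 ^ (q * L)\<close>.\<close>
  obtain k where k: "n = Suc k" using assms by (cases n) auto
  have lb: "2 ^ ((n - 1) * (q * L)) \<le> ?c x" if "x \<in> ?X" for x
    using card_stopping_ge[of L x n q] that assms
    by (metis (mono_tags, lifting) mem_Collect_eq of_nat_le_iff of_nat_numeral of_nat_power)
  have ub: "?c x \<le> 2 ^ (w * q) * 2 ^ ((n - 1) * (q * L))" if "x \<in> ?X" for x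
  proof -
    have "?c x \<le> real (2 ^ (w * q) * 2 ^ ((n - 1) * (q * L)))"
      using card_stopping_le[of L x n q] that assms unfolding of_nat_le_iff by auto
    then show ?thesis by simp
  qed
  have "real (n choose w) * 2 ^ ((n - 1) * (q * L)) \<le> sum ?c ?X"
    using sum_mono[of ?X, OF lb] by (simp add: card_weight_vecs)
  then show "real (n choose w) / 2 ^ (q * L) \<le> avg_ss_count (q * L) n L w"
    unfolding avg_ss_count_alt by (simp add: k field_simps power_add)
  have "sum ?c ?X \<le> real (n choose w) * (2 ^ (w * q) * 2 ^ ((n - 1) * (q * L)))"
    using sum_mono[of ?X, OF ub] by (simp add: card_weight_vecs)
  then show "avg_ss_count (q * L) n L w \<le> real (n choose w) * 2 ^ (w * q) / 2 ^ (q * L)"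
    unfolding avg_ss_count_alt by (simp add: k field_simps power_add)
qed

subsection \<open>Binomial coefficients and entropy\<close>

text \<open>Consecutive terms have ratio \<open>a / (k + 1)\<close>, which is at least 1 for
  \<open>k < a\<close> and at most 1 afterwards, so the sequence peaks at
  \<open>k = a\<close>.\<close>

lemma power_div_fact_le: "real a ^ k / fact k \<le> real a ^ a / fact a"
proof (cases "k \<le> a")
  case True
  then show ?thesis
  proof (induction k rule: inc_induct)
    case (step k)
    have "1 \<le> real a / real (Suc k)" using step by simp
    then have "real a ^ k / fact k * 1 \<le> real a ^ k / fact k * (real a / real (Suc k))"
      by (rule mult_left_mono) simp
    also have "\<dots> = real a ^ Suc k / fact (Suc k)" by (simp add: field_simps)
    finally show ?case using step by linarith
  qed simp
next
  case False
  then have "a \<le> k" by simp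
  then show ?thesis
  proof (induction k rule: dec_induct)
    case (step k)
    have "real a ^ Suc k / fact (Suc k) = real a ^ k / fact k * (real a / real (Suc k))"
      by (simp add: field_simps)
    also have "\<dots> \<le> real a ^ k / fact k"
      using step by (intro mult_right_le_one_le) (auto simp: field_simps)
    finally show ?case using step by linarith
  qed simp
qed

text \<open>Expand \<open>(w + (n - w)) ^ n\<close> binomially: the term at \<open>k = w\<close> is
  at most the whole sum, and it is the largest of the \<open>n + 1\<close> terms.\<close>

lemma binomial_bounds:
  assumes "w \<le> n"
  shows "real (n choose w) * (real w ^ w * real (n - w) ^ (n - w)) \<le> real n ^ n"
    and "real n ^ n \<le> real (n + 1) * real (n choose w) * (real w ^ w * real (n - w) ^ (n - w))"
proof -
  let ?t = "\<lambda>k. real (n choose k) * real w ^ k * real (n - w) ^ (n - k)"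
  have sum: "real n ^ n = (\<Sum>k\<le>n. ?t k)"
    using binomial_ring[of "real w" "real (n - w)" n] assms by (simp add: of_nat_diff)
  have "?t w \<le> (\<Sum>k\<le>n. ?t k)"
    using assms by (intro member_le_sum) auto
  then show "real (n choose w) * (real w ^ w * real (n - w) ^ (n - w)) \<le> real n ^ n"
    unfolding sum by (simp add: mult.assoc)
  \<comment> \<open>Both quotients peak at \<open>k = w\<close>, by the preceding estimate with
    \<open>a = w\<close> and \<open>a = n - w\<close>.\<close>
  have t: "?t k = fact n * (real w ^ k / fact k) * (real (n - w) ^ (n - k) / fact (n - k))" if "k \<le> n" for k
    using that by (simp add: binomial_fact)
  have "?t k \<le> ?t w" if "k \<le> n" for k
    unfolding t[OF that] t[OF assms]
    by (intro mult_mono mult_nonneg_nonneg power_div_fact_le) auto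
  then have "(\<Sum>k\<le>n. ?t k) \<le> (\<Sum>k\<le>n. ?t w)"
    by (intro sum_mono) auto
  then show "real n ^ n \<le> real (n + 1) * real (n choose w) * (real w ^ w * real (n - w) ^ (n - w))"
    unfolding sum by (simp add: mult.assoc)
qed

lemma log_power_self: "log b (real k ^ k) = real k * log b (real k)"
  by (cases "k = 0") (simp_all add: log_nat_power)

lemma bin_entropy_ratio:
  assumes "w \<le> n" "n > 0"
  shows "real n * bin_entropy (real w / real n) = log 2 (real n ^ n) - log 2 (real w ^ w * real (n - w) ^ (n - w))"
proof -
  have e: "real n * (real k / real n * log 2 (real k / real n)) = real k * log 2 k - real k * log 2 n" for k
    using assms by (cases "k = 0") (simp_all add: log_divide algebra_simps)
  have c: "1 - real w / real n = real (n - w) / real n"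
    using assms by (simp add: field_simps of_nat_diff)
  have "log 2 (real w ^ w * real (n - w) ^ (n - w)) = log 2 (real w ^ w) + log 2 (real (n - w) ^ (n - w))"
    by (rule log_mult_pos) auto
  then have "log 2 (real n ^ n) - log 2 (real w ^ w * real (n - w) ^ (n - w)) =
      real n * log 2 n - real w * log 2 w - real (n - w) * log 2 (n - w)"
    by (simp add: log_power_self)
  also have "\<dots> = - (real w * log 2 w - real w * log 2 n) - (real (n - w) * log 2 (n - w) - real (n - w) * log 2 n)"
    using assms by (simp add: algebra_simps of_nat_diff)
  also have "\<dots> = real n * bin_entropy (real w / real n)"
    unfolding e[symmetric] bin_entropy_def c by (simp add: algebra_simps)
  finally show ?thesis by simp
qed

lemma log_binomial_bounds:
  assumes "w \<le> n" "n > 0"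
  shows "log 2 (n choose w) \<le> real n * bin_entropy (real w / real n)"
    and "real n * bin_entropy (real w / real n) - log 2 (n + 1) \<le> log 2 (n choose w)"
proof -
  let ?p = "real w ^ w * real (n - w) ^ (n - w)"
  \<comment> \<open>As \<open>0 ^ 0 = 1\<close>, the extreme weights 0 and \<open>n\<close> cause no
    trouble with logarithms.\<close>
  have self: "real k ^ k > 0" for k by (cases k) auto
  have pos: "?p > 0" "real (n choose w) > 0" "real n ^ n > 0"
    using assms(1) mult_pos_pos[OF self self] self by (simp_all only: zero_less_binomial of_nat_0_less_iff)
  have "log 2 (real (n choose w) * ?p) \<le> log 2 (real n ^ n)"
    using binomial_bounds(1)[OF assms(1)] pos by (subst log_le_cancel_iff) auto
  also have "log 2 (real (n choose w) * ?p) = log 2 (n choose w) + log 2 ?p"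
    using pos by (intro log_mult_pos) auto
  finally show "log 2 (n choose w) \<le> real n * bin_entropy (real w / real n)"
    unfolding bin_entropy_ratio[OF assms] by simp
  have "log 2 (real n ^ n) \<le> log 2 (real (n + 1) * real (n choose w) * ?p)"
    using binomial_bounds(2)[OF assms(1)] pos by (subst log_le_cancel_iff) auto
  also have "\<dots> = log 2 (real (n + 1) * real (n choose w)) + log 2 ?p"
    using pos by (intro log_mult_pos) auto
  also have "log 2 (real (n + 1) * real (n choose w)) = log 2 (n + 1) + log 2 (n choose w)"
    using pos by (subst log_mult_pos) auto
  finally show "real n * bin_entropy (real w / real n) - log 2 (n + 1) \<le> log 2 (n choose w)"
    unfolding bin_entropy_ratio[OF assms] by simp
qed

text \<open>The derivative \<open>log 2 (1 - x) - log 2 x\<close> is nonnegative up to 1/2;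
  \<open>0 < a\<close> keeps the interval where it exists.\<close>

lemma bin_entropy_mono:
  assumes "0 < a" "a \<le> b" "b \<le> 1 / 2"
  shows "bin_entropy a \<le> bin_entropy b"
proof (rule DERIV_nonneg_imp_nondecreasing[OF assms(2)])
  fix x assume x: "a \<le> x" "x \<le> b"
  have x': "0 < x" "x < 1" using assms x by auto
  have "((\<lambda>x. (- (x * ln x) - (1 - x) * ln (1 - x)) / ln 2) has_real_derivative
      (- (ln x + 1) + (ln (1 - x) + 1)) / ln 2) (at x)"
    using x' by (auto intro!: derivative_eq_intros)
  moreover have "bin_entropy = (\<lambda>x. (- (x * ln x) - (1 - x) * ln (1 - x)) / ln 2)"
    by (auto simp: fun_eq_iff bin_entropy_def log_def diff_divide_distrib)
  ultimately have "(bin_entropy has_real_derivative (log 2 (1 - x) - log 2 x)) (at x)"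
    by (simp add: log_def diff_divide_distrib)
  moreover have "log 2 x \<le> log 2 (1 - x)"
    using assms x by (subst log_le_cancel_iff) auto
  ultimately show "\<exists>y. (bin_entropy has_real_derivative y) (at x) \<and> 0 \<le> y"
    by (intro exI[of _ "log 2 (1 - x) - log 2 x"]) simp
qed

subsection \<open>The growth rate\<close>

lemma Rats_common_multiple:
  assumes "x \<in> \<rat>" "y \<in> \<rat>" "z \<in> \<rat>"
  obtains d :: nat where "d > 0" "x * real d \<in> \<int>" "y * real d \<in> \<int>" "z * real d \<in> \<int>"
proof -
  have *: "\<exists>d::nat. d > 0 \<and> u * real d \<in> \<int>" if "u \<in> \<rat>" for u
  proof -
    from that obtain m :: int and k :: nat where "k \<noteq> 0" "u = of_int m / of_nat k"
      unfolding Rats_eq_int_div_nat by blast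
    then show ?thesis by (intro exI[of _ k]) simp
  qed
  obtain a b c :: nat where abc: "a > 0" "b > 0" "c > 0"
      "x * real a \<in> \<int>" "y * real b \<in> \<int>" "z * real c \<in> \<int>"
    using *[OF assms(1)] *[OF assms(2)] *[OF assms(3)] by auto
  show ?thesis
  proof (rule that[of "a * b * c"])
    have "x * real (a * b * c) = x * real a * of_nat (b * c)"
      "y * real (a * b * c) = y * real b * of_nat (a * c)"
      "z * real (a * b * c) = z * real c * of_nat (a * b)"
      by simp_all
    then show "x * real (a * b * c) \<in> \<int>" "y * real (a * b * c) \<in> \<int>" "z * real (a * b * c) \<in> \<int>"
      using abc by (metis Ints_mult Ints_of_nat)+
  qed (use abc in simp)
qed

text \<open>Multiples of a common denominator are admissible and arbitrarily large. Limits along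
  this filter are therefore unique, so \<open>Lim\<close> returns the actual limit.\<close>

lemma admissible_at_top_neq_bot:
  assumes "R \<in> \<rat>" "\<mu> \<in> \<rat>" "l \<in> \<rat>"
  shows "admissible_at_top R \<mu> l \<noteq> bot"
proof
  assume "admissible_at_top R \<mu> l = bot"
  then have "eventually (\<lambda>_. False) (admissible_at_top R \<mu> l)" by simp
  then have "eventually (\<lambda>n. n \<notin> admissible_lengths R \<mu> l) at_top"
    by (simp add: admissible_at_top_def eventually_inf_principal)
  then obtain N where N: "\<And>n. n \<ge> N \<Longrightarrow> n \<notin> admissible_lengths R \<mu> l"
    by (auto simp: eventually_at_top_linorder)
  obtain d :: nat where d: "d > 0" "(1 - R) * real d \<in> \<int>" "\<mu> * real d \<in> \<int>" "l * real d \<in> \<int>"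
    using Rats_common_multiple[of "1 - R" \<mu> l] assms by auto
  have "u * real (d * Suc N) \<in> \<int>" if "u * real d \<in> \<int>" for u
    using Ints_mult[OF that, of "of_nat (Suc N)"] by (simp only: of_nat_mult mult.assoc Ints_of_nat)
  then have "d * Suc N \<in> admissible_lengths R \<mu> l"
    using d by (simp only: admissible_lengths_def mem_Collect_eq) simp
  moreover have "d * Suc N \<ge> N" using d by (cases d) auto
  ultimately show False using N by blast
qed

lemma normalized_log_ss_bounds:
  assumes "0 < \<mu>" "0 < l" "l \<le> 1" "(1 - R) / \<mu> = real q"
    and n: "n \<in> admissible_lengths R \<mu> l"
  shows "bin_entropy l - (1 - R) - log 2 (n + 1) / n \<le> normalized_log_ss R \<mu> l n"
    and "normalized_log_ss R \<mu> l n \<le> bin_entropy l - (1 - R) * (1 - l / \<mu>)"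
proof -
  define L where "L = nat \<lfloor>\<mu> * real n\<rfloor>"
  define w where "w = nat \<lfloor>l * real n\<rfloor>"
  define A where "A = avg_ss_count (q * L) n L w"
  have "n > 0" using n by (simp add: admissible_lengths_def)
  have floor: "real (nat \<lfloor>u\<rfloor>) = u" if "u \<in> \<int>" "u \<ge> 0" for u
    using that by (elim Ints_cases) simp
  have L: "real L = \<mu> * n" and w: "real w = l * n"
    using n assms by (auto simp: L_def w_def admissible_lengths_def intro!: floor)
  \<comment> \<open>The number of blocks \<open>q\<close> is the same for all admissible lengths;
    only the block size \<open>L\<close> grows.\<close>
  have m: "(1 - R) * real n = real (q * L)"
  proof -
    have "1 - R = real q * \<mu>" using assms(1,4) by (simp add: nonzero_divide_eq_eq)
    then show ?thesis by (simp add: L)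
  qed
  have norm: "normalized_log_ss R \<mu> l n = log 2 A / n"
    unfolding normalized_log_ss_def m floor_of_nat nat_int A_def L_def w_def ..
  have "real L > 0" "real w > 0" using L w \<open>n > 0\<close> assms by auto
  then have "L > 0" "w > 0" by simp_all
  have "real w \<le> real n" using w mult_right_mono[OF \<open>l \<le> 1\<close>, of "real n"] by simp
  then have "w \<le> n" by simp
  have ratio: "real w / real n = l" using w \<open>n > 0\<close> by simp
  note log_C = log_binomial_bounds[OF \<open>w \<le> n\<close> \<open>n > 0\<close>, unfolded ratio]
  note A_bounds = avg_ss_count_bounds[OF \<open>L > 0\<close> \<open>w > 0\<close> \<open>n > 0\<close>, of q, folded A_def]
  have C: "real (n choose w) > 0" using \<open>w \<le> n\<close> by (simp add: zero_less_binomial)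
  then have "A > 0"
    by (intro less_le_trans[OF _ A_bounds(1)] divide_pos_pos) simp_all
  have "log 2 (n choose w) - real (q * L) = log 2 (real (n choose w) / 2 ^ (q * L))"
    using C by (simp add: log_divide_pos log_nat_power)
  also have "\<dots> \<le> log 2 A"
    using C A_bounds(1) \<open>A > 0\<close> by (subst log_le_cancel_iff) auto
  finally have "real n * bin_entropy l - log 2 (n + 1) - (1 - R) * n \<le> log 2 A"
    using log_C(2) m by linarith
  then have "(real n * bin_entropy l - log 2 (n + 1) - (1 - R) * n) / n \<le> log 2 A / n"
    by (rule divide_right_mono) simp
  moreover have "(real n * bin_entropy l - log 2 (n + 1) - (1 - R) * n) / n = bin_entropy l - (1 - R) - log 2 (n + 1) / n"
    using \<open>n > 0\<close> by (simp add: diff_divide_distrib)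
  ultimately show "bin_entropy l - (1 - R) - log 2 (n + 1) / n \<le> normalized_log_ss R \<mu> l n"
    by (simp add: norm)
  \<comment> \<open>The union bound factor \<open>2 ^ (w * q)\<close> contributes
    \<open>l * q = (1 - R) * l / \<mu>\<close> to the exponent per symbol.\<close>
  have "log 2 A \<le> log 2 (real (n choose w) * 2 ^ (w * q) / 2 ^ (q * L))"
    using C A_bounds(2) \<open>A > 0\<close> by (subst log_le_cancel_iff) auto
  also have "\<dots> = log 2 (n choose w) + real (w * q) - real (q * L)"
    using C by (simp add: log_divide_pos log_mult_pos log_nat_power)
  also have "\<dots> \<le> real n * bin_entropy l + l * n * q - (1 - R) * n"
    using log_C(1) m w by simp
  finally have "log 2 A / n \<le> (real n * bin_entropy l + l * n * q - (1 - R) * n) / n"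
    by (rule divide_right_mono) simp
  also have "\<dots> = bin_entropy l + l * q - (1 - R)"
    using \<open>n > 0\<close> by (simp add: diff_divide_distrib add_divide_distrib)
  also have "\<dots> = bin_entropy l - (1 - R) * (1 - l / \<mu>)"
    unfolding assms(4)[symmetric] by (simp add: algebra_simps)
  finally show "normalized_log_ss R \<mu> l n \<le> bin_entropy l - (1 - R) * (1 - l / \<mu>)"
    by (simp add: norm)
qed

lemma growth_rate_bounds:
  assumes "R \<in> \<rat>" "\<mu> \<in> \<rat>" "l \<in> \<rat>" "0 < \<mu>" "0 < l" "l \<le> 1" "(1 - R) / \<mu> = real q"
    and lim: "(normalized_log_ss R \<mu> l \<longlongrightarrow> s) (admissible_at_top R \<mu> l)"
  shows "bin_entropy l - (1 - R) \<le> growth_rate R \<mu> l"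
    and "growth_rate R \<mu> l \<le> bin_entropy l - (1 - R) * (1 - l / \<mu>)"
proof -
  let ?F = "admissible_at_top R \<mu> l"
  note nonbot = admissible_at_top_neq_bot[OF assms(1-3)]
  have "eventually (\<lambda>n. n \<in> admissible_lengths R \<mu> l) ?F"
    by (simp add: admissible_at_top_def eventually_inf_principal)
  note ev = eventually_mono[OF this]
  \<comment> \<open>The factor \<open>n + 1\<close> lost in the binomial estimate is
    subexponential.\<close>
  have "((\<lambda>n. log 2 (real n + 1) / real n) \<longlongrightarrow> 0) at_top"
    by real_asymp
  then have "((\<lambda>n. log 2 (real n + 1) / real n) \<longlongrightarrow> 0) ?F"
    by (rule tendsto_mono[rotated]) (simp add: admissible_at_top_def)
  then have low: "((\<lambda>n. bin_entropy l - (1 - R) - log 2 (real n + 1) / real n) \<longlongrightarrow> bin_entropy l - (1 - R) - 0) ?F"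
    by (intro tendsto_diff tendsto_const)
  have "bin_entropy l - (1 - R) - 0 \<le> s"
    using normalized_log_ss_bounds(1)[OF assms(4-7)]
    by (intro tendsto_le[OF nonbot lim low] ev) (simp add: add.commute)
  moreover have "s \<le> bin_entropy l - (1 - R) * (1 - l / \<mu>)"
    using normalized_log_ss_bounds(2)[OF assms(4-7)]
    by (intro tendsto_upperbound[OF lim _ nonbot] ev)
  moreover have "growth_rate R \<mu> l = s"
    unfolding growth_rate_def by (rule tendsto_Lim[OF nonbot lim])
  ultimately show "bin_entropy l - (1 - R) \<le> growth_rate R \<mu> l"
    "growth_rate R \<mu> l \<le> bin_entropy l - (1 - R) * (1 - l / \<mu>)"
    by simp_all
qed

section \<open>Locating the critical exponent\<close>

text \<open>The function is negative at 0, so the intermediate value theorem puts a zero in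
  \<open>(0, l]\<close>, and \<open>alpha_L\<close> is the least positive one.\<close>

lemma alpha_L_le:
  assumes "0 < R" "R < 1" "0 < \<mu>" "\<mu> \<le> 1 - R" "0 < l" "l \<le> 1"
    and nonneg: "bin_entropy l - (1 - R) * (1 - l / \<mu>) \<ge> 0"
  shows "alpha_L R \<mu> \<le> l"
proof -
  let ?f = "\<lambda>l. bin_entropy l - (1 - R) * (1 - l / \<mu>)"
  have "continuous_on {0..l} ?f"
    by (intro continuous_intros continuous_on_subset[OF continuous_on_bin_entropy]) (use assms in auto)
  moreover have "?f 0 < 0" using assms by (simp add: bin_entropy_def)
  ultimately obtain z where z: "0 \<le> z" "z \<le> l" "?f z = 0"
    using IVT'[of ?f 0 0 l] assms by auto
  with \<open>?f 0 < 0\<close> have "z \<noteq> 0" by (intro notI) simp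
  then have "alpha_L R \<mu> \<le> z"
    using alpha_L_works(4)[OF assms(1-4), of z] z assms by simp
  with z show ?thesis by simp
qed

text \<open>Entropy climbs from 0 at 0 to 1 at 1/2 and \<open>1 - R\<close> lies strictly between.
  The strict bound leaves room to the right of \<open>alpha_U\<close> where entropy is still
  increasing.\<close>

lemma alpha_U_less_half:
  assumes "0 < R" "R < 1"
  shows "alpha_U R \<mu> < 1 / 2"
proof -
  let ?f = "\<lambda>l. bin_entropy l - (1 - R)"
  have half: "bin_entropy (1 / 2) = 1" by (simp add: bin_entropy_def log_divide)
  have zero: "bin_entropy 0 = 0" by (simp add: bin_entropy_def)
  have "continuous_on {0..1/2} ?f"
    by (intro continuous_intros continuous_on_subset[OF continuous_on_bin_entropy]) auto
  then obtain z where z: "0 \<le> z" "z \<le> 1 / 2" "?f z = 0"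
    using IVT'[of ?f 0 0 "1 / 2"] assms half zero by auto
  with zero half assms have "bin_entropy z \<noteq> bin_entropy 0" "bin_entropy z \<noteq> bin_entropy (1 / 2)"
    by simp_all
  then have "z \<noteq> 0" "z \<noteq> 1 / 2" by blast+
  then have "alpha_U R \<mu> \<le> z"
    using alpha_U_works(4)[OF assms, of z] z by simp
  with z \<open>z \<noteq> 1 / 2\<close> show ?thesis by simp
qed

theorem lemma12:
  fixes R \<mu> :: real
  assumes "R \<in> \<rat>" and "\<mu> \<in> \<rat>"
    and "0 < R" and "R < 1"
    and "0 < \<mu>" and "\<mu> \<le> 1 - R"
    and "(1 - R) / \<mu> \<in> \<int>"
    and limit_exists: "\<And>l. l \<in> \<rat> \<Longrightarrow> 0 < l \<Longrightarrow> l \<le> 1 \<Longrightarrow>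
      \<exists>s. (normalized_log_ss R \<mu> l \<longlongrightarrow> s) (admissible_at_top R \<mu> l)"
  shows "alpha_L R \<mu> \<le> critical_exponent R \<mu> \<and> critical_exponent R \<mu> \<le> alpha_U R \<mu>"
proof -
  let ?S = "{l. l \<in> \<rat> \<and> 0 < l \<and> l \<le> 1 \<and> growth_rate R \<mu> l \<ge> 0}"
  note U = alpha_U_works[OF assms(3,4), of \<mu>] and half = alpha_U_less_half[OF assms(3,4), of \<mu>]
  have "(1 - R) / \<mu> \<ge> 0" using assms by simp
  with assms(7) obtain q where q: "(1 - R) / \<mu> = real q"
    by (metis Ints_cases of_int_0_le_iff of_int_of_nat_eq zero_le_imp_eq_int)
  have growth: "bin_entropy l - (1 - R) \<le> growth_rate R \<mu> l"
      "growth_rate R \<mu> l \<le> bin_entropy l - (1 - R) * (1 - l / \<mu>)"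
    if l: "l \<in> \<rat>" "0 < l" "l \<le> 1" for l
  proof -
    obtain s where "(normalized_log_ss R \<mu> l \<longlongrightarrow> s) (admissible_at_top R \<mu> l)"
      using limit_exists[OF l] by blast
    from growth_rate_bounds[OF assms(1,2) l(1) assms(5) l(2,3) q this]
    show "bin_entropy l - (1 - R) \<le> growth_rate R \<mu> l"
      "growth_rate R \<mu> l \<le> bin_entropy l - (1 - R) * (1 - l / \<mu>)" .
  qed
  have mem: "l \<in> ?S" if "l \<in> \<rat>" "alpha_U R \<mu> < l" "l < 1 / 2" for l
  proof -
    have "bin_entropy (alpha_U R \<mu>) \<le> bin_entropy l"
      using bin_entropy_mono that U(1) by simp
    then show ?thesis using that U(1,3) growth(1)[of l] by simp
  qed
  \<comment> \<open>\<open>alpha_U\<close> may be irrational or have no growth rate of its own, so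
    the infimum is bounded through rationals approaching it from the right.\<close>
  have approx: "\<exists>l\<in>?S. l < b" if "alpha_U R \<mu> < b" for b
  proof -
    have "alpha_U R \<mu> < min b (1 / 2)" using that half by simp
    from Rats_dense_in_real[OF this] show ?thesis using mem by auto
  qed
  have bdd: "bdd_below ?S" by (rule bdd_belowI[of _ 0]) simp
  have "alpha_L R \<mu> \<le> Inf ?S"
  proof (rule cInf_greatest)
    show "?S \<noteq> {}" using approx[OF half] by blast
  next
    fix l assume "l \<in> ?S"
    then show "alpha_L R \<mu> \<le> l"
      using growth(2)[of l] by (intro alpha_L_le[OF assms(3-6)]) auto
  qed
  moreover have "Inf ?S \<le> alpha_U R \<mu>"
  proof (rule dense_ge)
    fix b assume "alpha_U R \<mu> < b"
    from approx[OF this] obtain l where "l \<in> ?S" "l < b" by blast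
    with cInf_lower[OF _ bdd] show "Inf ?S \<le> b" by (meson less_imp_le order_trans)
  qed
  ultimately show ?thesis by (simp add: critical_exponent_def)
qed

end
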